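(* Let $n,d\ge1$, $\lambda>0$, $b>0$, and let $P$ be any distribution on $\mathbf{R}^d\times\mathbf{R}$ such that, for $(X,Y)\sim P$, $|Y|\le b$ almost surely and $\Sigma=\mathbf{E}[XX^{\mathsf T}]$ exists. Let $(X_1,Y_1),\dots,(X_n,Y_n)$ be i.i.d. with distribution $P$. Then the estimators $\widehat f_\lambda$ (ridge FW) and $\widehat g_{\lambda,b}$ (truncated ridge) defined in the context satisfy $$\mathbf{E}\big[R(\widehat f_\lambda)\big]\le\inf_{\theta\in\mathbf{R}^d}\big\{R(\theta)+\lambda\|\theta\|^2\big\}+2b^2\,\frac{\mathrm{Tr}[(\Sigma+\lambda I_d)^{-1}\Sigma]}{n+1},$$ $$\mathbf{E}\big[R(\widehat g_{\lambda,b})\big]\le\inf_{\theta\in\mathbf{R}^d}\big\{R(\theta)+\lambda\|\theta\|^2\big\}+8b^2\,\frac{\mathrm{Tr}[(\Sigma+\lambda I_d)^{-1}\Sigma]}{n+1}.$$ In addition, let $\widehat b=\max_{1\le i\le n}|Y_i|$ and $\widehat g_\lambda(x)=\widehat g_{\lambda,\widehat b}(x)$. Then $$\mathbf{E}\big[R(\widehat g_\lambda)\big]\le\inf_{\theta\in\mathbf{R}^d}\big\{R(\theta)+\lambda\|\theta\|^2\big\}+8b^2\,\frac{\mathrm{Tr}[(\Sigma+\lambda I_d)^{-1}\Sigma]}{n+1}+\frac{b^2}{n+1}.$$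
   Context: Risks: $R(f)=\mathbf{E}_{(X,Y)\sim P}[(f(X)-Y)^2]$ for $f:\mathbf{R}^d\to\mathbf{R}$ (for a data-dependent $f$, the expectation is over an independent pair $(X,Y)$; the outer $\mathbf{E}$ is over the sample), and $R(\theta)=R(f_\theta)$ with $f_\theta(x)=\langle\theta,x\rangle$. $R_n(\theta)=\frac1n\sum_{i=1}^n(\langle\theta,X_i\rangle-Y_i)^2$ and $\widehat\Sigma_n=\frac1n\sum_{i=1}^nX_iX_i^{\mathsf T}$. For $\mu>0$, the ridge estimator is $\widehat\theta_\mu=\arg\min_{\theta\in\mathbf{R}^d}\{R_n(\theta)+\mu\|\theta\|^2\}=(\widehat\Sigma_n+\mu I_d)^{-1}\cdot\frac1n\sum_{i=1}^nY_iX_i$, and the ridge leverage score of $x\in\mathbf{R}^d$ is $$h_\mu(x)=\bigg\langle\bigg(\sum_{i=1}^nX_iX_i^{\mathsf T}+\mu nI_d+xx^{\mathsf T}\bigg)^{-1}x,x\bigg\rangle.$$ Set $\lambda'=(1+1/n)\lambda$. The ridge FW estimator is $\widehat f_\lambda(x)=(1-h_{\lambda'}(x))^2\cdot\langle\widehat\theta_{\lambda'},x\rangle$. For $a\ge0$, the truncation function is $\psi_a(t)=\max(-a,\min(a,t))$, $t\in\mathbf{R}$, and the truncated ridge estimator is $\widehat g_{\lambda,a}(x)=\psi_a(\langle\widehat\theta_{\lambda'},x\rangle)$. *)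

theory Defs
  imports "HOL-Probability.Probability"
begin

type_synonym 'd obs = "(real ^ 'd) \<times> real"

text \<open>A sample \<open>(X\<^sub>1, Y\<^sub>1), \<dots>, (X\<^sub>n, Y\<^sub>n)\<close> is a function \<open>D\<close> on \<open>nat\<close>, of which only
  the values at \<open>1, \<dots>, n\<close> are used: \<open>X\<^sub>i = fst (D i)\<close> and \<open>Y\<^sub>i = snd (D i)\<close>.\<close>

definition outer :: "real ^ 'd \<Rightarrow> real ^ 'd ^ 'd" where
  "outer x = (\<chi> i j. x $ i * x $ j)"

text \<open>The risk is an extended nonnegative integral, so a bound by a finite quantity includes the
  finiteness of the risk.\<close>

definition risk :: "('d::finite) obs measure \<Rightarrow> (real ^ 'd \<Rightarrow> real) \<Rightarrow> ennreal" where
  "risk P f = (\<integral>\<^sup>+ z. ennreal ((f (fst z) - snd z)\<^sup>2) \<partial>P)"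

definition lin_pred :: "real ^ 'd \<Rightarrow> real ^ 'd \<Rightarrow> real" where
  "lin_pred \<theta> x = \<theta> \<bullet> x"

definition second_moment :: "('d::finite) obs measure \<Rightarrow> real ^ 'd ^ 'd" where
  "second_moment P = (\<integral> z. outer (fst z) \<partial>P)"

definition emp_risk :: "nat \<Rightarrow> (nat \<Rightarrow> ('d::finite) obs) \<Rightarrow> real ^ 'd \<Rightarrow> real" where
  "emp_risk n D \<theta> = (\<Sum>i=1..n. (\<theta> \<bullet> fst (D i) - snd (D i))\<^sup>2) / real n"

definition emp_second_moment :: "nat \<Rightarrow> (nat \<Rightarrow> ('d::finite) obs) \<Rightarrow> real ^ 'd ^ 'd" where
  "emp_second_moment n D = (1 / real n) *\<^sub>R (\<Sum>i=1..n. outer (fst (D i)))"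

definition ridge :: "nat \<Rightarrow> real \<Rightarrow> (nat \<Rightarrow> ('d::finite) obs) \<Rightarrow> real ^ 'd" where
  "ridge n \<mu> D = arg_min (\<lambda>\<theta>. emp_risk n D \<theta> + \<mu> * (norm \<theta>)\<^sup>2) (\<lambda>_. True)"

definition ridge_leverage ::
    "nat \<Rightarrow> real \<Rightarrow> (nat \<Rightarrow> ('d::finite) obs) \<Rightarrow> real ^ 'd \<Rightarrow> real" where
  "ridge_leverage n \<mu> D x =
     (matrix_inv ((\<Sum>i=1..n. outer (fst (D i))) + mat (\<mu> * real n) + outer x) *v x) \<bullet> x"

definition adj_lambda :: "nat \<Rightarrow> real \<Rightarrow> real" where
  "adj_lambda n l = (1 + 1 / real n) * l"

definition ridge_fw ::
    "nat \<Rightarrow> real \<Rightarrow> (nat \<Rightarrow> ('d::finite) obs) \<Rightarrow> real ^ 'd \<Rightarrow> real" where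
  "ridge_fw n l D x =
     (1 - ridge_leverage n (adj_lambda n l) D x)\<^sup>2 * (ridge n (adj_lambda n l) D \<bullet> x)"

definition trunc :: "real \<Rightarrow> real \<Rightarrow> real" where
  "trunc a t = max (- a) (min a t)"

definition trunc_ridge ::
    "nat \<Rightarrow> real \<Rightarrow> real \<Rightarrow> (nat \<Rightarrow> ('d::finite) obs) \<Rightarrow> real ^ 'd \<Rightarrow> real" where
  "trunc_ridge n l a D x = trunc a (ridge n (adj_lambda n l) D \<bullet> x)"

definition max_abs_label :: "nat \<Rightarrow> (nat \<Rightarrow> ('d::finite) obs) \<Rightarrow> real" where
  "max_abs_label n D = Max ((\<lambda>i. \<bar>snd (D i)\<bar>) ` {1..n})"

definition ridge_oracle_risk :: "('d::finite) obs measure \<Rightarrow> real \<Rightarrow> ennreal" where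
  "ridge_oracle_risk P l = (INF \<theta>. risk P (lin_pred \<theta>) + ennreal (l * (norm \<theta>)\<^sup>2))"

definition deg_freedom :: "('d::finite) obs measure \<Rightarrow> real \<Rightarrow> real" where
  "deg_freedom P l = trace (matrix_inv (second_moment P + mat l) ** second_moment P)"


lemma outer_mult_vec: "outer x *v y = (x \<bullet> y) *\<^sub>R x"
  by (simp add: outer_def matrix_vector_mult_def inner_vec_def vec_eq_iff
      sum_distrib_left sum_distrib_right mult_ac)

lemma mat_mult_vec: "mat c *v (y :: real ^ 'd) = c *\<^sub>R y"
proof -
  have "mat c = c *\<^sub>R (mat 1 :: real ^ 'd ^ 'd)"
    by (simp add: mat_def vec_eq_iff)
  then show ?thesis by (simp add: scaleR_matrix_vector_assoc[symmetric])
qed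

lemma sum_matrix_mult_vec: "(\<Sum>i\<in>I. A i) *v (y :: real ^ 'd) = (\<Sum>i\<in>I. A i *v y)"
  by (induction I rule: infinite_finite_induct) (auto simp: matrix_vector_mult_add_rdistrib)

lemma emp_second_moment_mult_vec:
  "emp_second_moment n D *v y = (1 / real n) *\<^sub>R (\<Sum>i=1..n. (fst (D i) \<bullet> y) *\<^sub>R fst (D i))"
  by (simp add: emp_second_moment_def scaleR_matrix_vector_assoc[symmetric]
      sum_matrix_mult_vec outer_mult_vec)

text \<open>The minimizer in the definition of \<^const>\<open>ridge\<close> exists and is unique.\<close>

lemma ridge_closed_form:
  fixes n :: nat and \<mu> :: real and D :: "nat \<Rightarrow> ('d::finite) obs"
  assumes mu: "\<mu> > 0"
  defines "A \<equiv> emp_second_moment n D + mat \<mu>"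
    and "v \<equiv> (1 / real n) *\<^sub>R (\<Sum>i=1..n. snd (D i) *\<^sub>R fst (D i))"
    and "J \<equiv> \<lambda>\<theta>. emp_risk n D \<theta> + \<mu> * (norm \<theta>)\<^sup>2"
  shows "invertible A"
    and "ridge n \<mu> D = matrix_inv A *v v"
    and "\<theta> \<noteq> ridge n \<mu> D \<Longrightarrow> J (ridge n \<mu> D) < J \<theta>"
proof -
  have Av: "A *v y = (1 / real n) *\<^sub>R (\<Sum>i=1..n. (fst (D i) \<bullet> y) *\<^sub>R fst (D i)) + \<mu> *\<^sub>R y" for y
    by (simp add: A_def matrix_vector_mult_add_rdistrib emp_second_moment_mult_vec mat_mult_vec)
  have "y = 0" if "A *v y = 0" for y
  proof -
    have "0 = (A *v y) \<bullet> y" using that by simp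
    also have "\<dots> = (\<Sum>i=1..n. (fst (D i) \<bullet> y)\<^sup>2) / real n + \<mu> * (norm y)\<^sup>2"
      by (simp add: Av inner_add_left inner_sum_left dot_square_norm)
        (simp add: power2_eq_square)
    finally have "(\<Sum>i=1..n. (fst (D i) \<bullet> y)\<^sup>2) / real n + \<mu> * (norm y)\<^sup>2 = 0" by simp
    moreover have "(\<Sum>i=1..n. (fst (D i) \<bullet> y)\<^sup>2) / real n \<ge> 0"
      by (intro divide_nonneg_nonneg sum_nonneg) auto
    moreover have "\<mu> * (norm y)\<^sup>2 \<ge> 0" using mu by simp
    ultimately have "\<mu> * (norm y)\<^sup>2 = 0" by linarith
    then show ?thesis using mu by simp
  qed
  then have "\<exists>B. B ** A = mat 1" unfolding matrix_left_invertible_ker by blast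
  then show inv: "invertible A" by (simp add: invertible_left_inverse)
  define t where "t = matrix_inv A *v v"
  have "A ** matrix_inv A = mat 1"
    using someI_ex[OF inv[unfolded invertible_def]] by (simp add: matrix_inv_def)
  then have At: "A *v t = v"
    by (simp add: t_def matrix_vector_mul_assoc)
  have diff: "J u = J t + ((\<Sum>i=1..n. ((u - t) \<bullet> fst (D i))\<^sup>2) / real n + \<mu> * (norm (u - t))\<^sup>2)" for u
  proof -
    have "(u - t) \<bullet> (A *v t - v) = 0" using At by simp
    then have z: "(\<Sum>i=1..n. (t \<bullet> fst (D i) - snd (D i)) * ((u - t) \<bullet> fst (D i))) / real n
          + \<mu> * ((u - t) \<bullet> t) = 0"
      by (simp add: Av v_def inner_add_right inner_diff_right inner_sum_right
          diff_divide_distrib sum_subtractf left_diff_distrib inner_commute)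
    have "(\<Sum>i=1..n. (u \<bullet> fst (D i) - snd (D i))\<^sup>2) =
        (\<Sum>i=1..n. (t \<bullet> fst (D i) - snd (D i))\<^sup>2 + ((u - t) \<bullet> fst (D i))\<^sup>2
           + 2 * ((t \<bullet> fst (D i) - snd (D i)) * ((u - t) \<bullet> fst (D i))))"
      by (intro sum.cong refl) (simp add: inner_diff_left power2_eq_square algebra_simps)
    also have "\<dots> = (\<Sum>i=1..n. (t \<bullet> fst (D i) - snd (D i))\<^sup>2) + (\<Sum>i=1..n. ((u - t) \<bullet> fst (D i))\<^sup>2)
           + 2 * (\<Sum>i=1..n. (t \<bullet> fst (D i) - snd (D i)) * ((u - t) \<bullet> fst (D i)))"
      by (simp add: sum.distrib sum_distrib_left)
    finally have e: "emp_risk n D u = emp_risk n D t + (\<Sum>i=1..n. ((u - t) \<bullet> fst (D i))\<^sup>2) / real n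
        + 2 * ((\<Sum>i=1..n. (t \<bullet> fst (D i) - snd (D i)) * ((u - t) \<bullet> fst (D i))) / real n)"
      by (simp add: emp_risk_def add_divide_distrib)
    have "(norm u)\<^sup>2 = (norm t)\<^sup>2 + (norm (u - t))\<^sup>2 + 2 * ((u - t) \<bullet> t)"
      by (simp add: power2_norm_eq_inner inner_diff_left inner_diff_right inner_commute)
    then have "\<mu> * (norm u)\<^sup>2 = \<mu> * (norm t)\<^sup>2 + \<mu> * (norm (u - t))\<^sup>2 + 2 * (\<mu> * ((u - t) \<bullet> t))"
      by (simp only: distrib_left mult.left_commute)
    with e z show ?thesis unfolding J_def by linarith
  qed
  have less: "J t < J u" if "u \<noteq> t" for u
  proof -
    have "(\<Sum>i=1..n. ((u - t) \<bullet> fst (D i))\<^sup>2) / real n \<ge> 0"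
      by (intro divide_nonneg_nonneg sum_nonneg) auto
    moreover have "\<mu> * (norm (u - t))\<^sup>2 > 0" using mu that by simp
    ultimately show ?thesis using diff[of u] by linarith
  qed
  have "is_arg_min J (\<lambda>_. True) u \<longleftrightarrow> u = t" for u
    using less[of u] less by (auto simp: is_arg_min_def) (metis less_asym)
  then have "arg_min J (\<lambda>_. True) = t"
    by (simp add: arg_min_def)
  then have r: "ridge n \<mu> D = t" by (simp add: ridge_def J_def)
  then show "ridge n \<mu> D = matrix_inv A *v v" by (simp add: t_def)
  show "J (ridge n \<mu> D) < J \<theta>" if "\<theta> \<noteq> ridge n \<mu> D" using less that r by simp
qed

end

theory Submission
  imports Defs
begin

text \<open>The argument is a leave-one-out computation. Put \<open>N = n + 1\<close> and enlarge the sample by the test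
  point, so that there are \<open>N\<close> exchangeable observations; the expected risk is the expectation of
  the average over \<open>i \<le> N\<close> of the squared error made on observation \<open>i\<close> by the estimator trained on
  the other \<open>n\<close> (\<open>nn_integral_sample_eq_PiM\<close>, \<open>nn_integral_hold_out\<close>). With \<open>\<lambda>' = (1 + 1/n) \<lambda>\<close> the
  unnormalized penalty \<open>\<lambda>' n = \<lambda> N\<close> is the same with and without the held-out point. Let
  \<open>A = \<Sum>i\<le>N. X\<^sub>i X\<^sub>i\<^sup>T + \<lambda> N I\<close>, let \<open>h\<^sub>i = \<langle>A\<^sup>-\<^sup>1 X\<^sub>i, X\<^sub>i\<rangle>\<close>, and let \<open>r\<^sub>i\<close> be the residual at
  observation \<open>i\<close> of the ridge estimator trained on all \<open>N\<close> observations. The ridge prediction \<open>p\<^sub>i\<close>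
  without observation \<open>i\<close> satisfies \<open>(p\<^sub>i - Y\<^sub>i) (1 - h\<^sub>i) = r\<^sub>i\<close> (\<open>hold_out_residual\<close>), and the
  leverage score used by the FW estimator is exactly \<open>h\<^sub>i\<close>.

  Elementary inequalities then bound the squared leave-one-out error by \<open>r\<^sub>i\<^sup>2 + 2 b\<^sup>2 h\<^sub>i\<close> for the FW
  estimator and by \<open>r\<^sub>i\<^sup>2 + 8 b\<^sup>2 h\<^sub>i\<close> for truncation at \<open>b\<close> (\<open>fw_error_bound\<close>, \<open>trunc_error_bound\<close>).
  When truncating at the largest remaining label, an extra \<open>b\<^sup>2\<close> is needed only if \<open>\<bar>Y\<^sub>i\<bar>\<close> exceeds all
  other labels, which happens for at most one \<open>i\<close>.

  Two facts finish the proof. Since the full ridge estimator minimizes the penalized empirical risk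
  on \<open>N\<close> points, \<open>\<Sum>i\<le>N. r\<^sub>i\<^sup>2\<close> is at most \<open>\<Sum>i\<le>N. (\<langle>\<theta>, X\<^sub>i\<rangle> - Y\<^sub>i)\<^sup>2 + \<lambda> N \<parallel>\<theta>\<parallel>\<^sup>2\<close> for every \<open>\<theta>\<close>,
  whose expectation is \<open>N (R(\<theta>) + \<lambda> \<parallel>\<theta>\<parallel>\<^sup>2)\<close>. And \<open>\<Sum>i\<le>N. h\<^sub>i = d - \<lambda> N Tr(A\<^sup>-\<^sup>1)\<close>, whose
  expectation is at most \<open>Tr((\<Sigma> + \<lambda> I)\<^sup>-\<^sup>1 \<Sigma>)\<close> by convexity of the trace of the inverse. The latter
  is used in the form of the supporting affine function
  \<open>\<langle>A\<^sup>-\<^sup>1 e, e\<rangle> \<ge> 2 \<langle>e, w\<rangle> - \<langle>w, A w\<rangle>\<close> with \<open>w = (\<Sigma> + \<lambda> I)\<^sup>-\<^sup>1 e / N\<close>; it bounds \<open>\<Sum>i\<le>N. h\<^sub>i\<close> by an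
  integrable function of explicit expectation (\<open>expectation_leverage_majorant\<close>).\<close>

section \<open>Positive definite matrices and traces\<close>

lemma matrix_inv_mult_cancel:
  fixes A :: "real ^ 'd ^ 'd"
  assumes "invertible A"
  shows "A *v (matrix_inv A *v x) = x" and "matrix_inv A *v (A *v x) = x"
proof -
  have "A ** matrix_inv A = mat 1 \<and> matrix_inv A ** A = mat 1"
    using someI_ex[OF assms[unfolded invertible_def]] by (simp add: matrix_inv_def)
  then show "A *v (matrix_inv A *v x) = x" and "matrix_inv A *v (A *v x) = x"
    by (simp_all add: matrix_vector_mul_assoc)
qed

lemma invertible_of_pos_def:
  fixes A :: "real ^ 'd ^ 'd"
  assumes "\<And>x. x \<noteq> 0 \<Longrightarrow> x \<bullet> (A *v x) > 0"
  shows "invertible A"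
proof -
  have "x = 0" if "A *v x = 0" for x
    using assms[of x] that by fastforce
  then have "\<exists>B. B ** A = mat 1" unfolding matrix_left_invertible_ker by blast
  then show ?thesis by (simp add: invertible_left_inverse)
qed

lemma trace_eq_sum_inner: "trace B = (\<Sum>k\<in>UNIV. (B *v axis k 1) \<bullet> axis k (1::real))"
  by (simp add: trace_def inner_axis matrix_vector_mult_basis column_def)

lemma trace_mult_outer: "trace (B ** outer x) = (B *v x) \<bullet> x"
  by (simp add: trace_def outer_def matrix_matrix_mult_def matrix_vector_mult_def inner_vec_def
      sum_distrib_right sum_distrib_left mult_ac)

lemma trace_matrix_inv_mult:
  fixes S :: "real ^ 'd ^ 'd"
  assumes "invertible (S + mat c)"
  shows "trace (matrix_inv (S + mat c) ** S)
    = real CARD('d) - c * (\<Sum>k\<in>UNIV. (matrix_inv (S + mat c) *v axis k 1) \<bullet> axis k 1)"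
proof -
  let ?B = "matrix_inv (S + mat c)"
  have "(?B ** S) *v x = x - c *\<^sub>R (?B *v x)" for x
  proof -
    have "(?B ** S) *v x = ?B *v ((S + mat c) *v x - c *\<^sub>R x)"
      by (simp add: matrix_vector_mul_assoc[symmetric] matrix_vector_mult_add_rdistrib mat_mult_vec)
    also have "\<dots> = x - c *\<^sub>R (?B *v x)"
      by (simp only: matrix_vector_mult_diff_distrib matrix_inv_mult_cancel[OF assms]
          matrix_vector_mult_scaleR)
    finally show ?thesis .
  qed
  then show ?thesis
    by (simp add: trace_eq_sum_inner inner_diff_left sum_subtractf sum_distrib_left inner_axis_axis)
qed

section \<open>Regularized Gram matrices and leverages\<close>

text \<open>The matrix \<open>\<Sum>i\<in>I. X\<^sub>i X\<^sub>i\<^sup>T + m I\<close>; the penalty \<open>m\<close> is not normalized by the number of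
  observations.\<close>

definition reg_gram :: "'i set \<Rightarrow> real \<Rightarrow> ('i \<Rightarrow> ('d::finite) obs) \<Rightarrow> real ^ 'd ^ 'd" where
  "reg_gram I m D = (\<Sum>i\<in>I. outer (fst (D i))) + mat m"

text \<open>The ridge leverage \<open>\<langle>A\<^sup>-\<^sup>1 X\<^sub>i, X\<^sub>i\<rangle>\<close> of observation \<open>i\<close>, where \<open>A\<close> is the regularized Gram
  matrix of all observations indexed by \<open>I\<close>. For \<open>i \<in> I\<close> it is therefore the leverage of \<open>X\<^sub>i\<close>
  relative to the other observations in the sense of \<^const>\<open>ridge_leverage\<close>, where the point itself
  is added to the Gram matrix.\<close>

definition leverage :: "'i set \<Rightarrow> real \<Rightarrow> ('i \<Rightarrow> ('d::finite) obs) \<Rightarrow> 'i \<Rightarrow> real" where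
  "leverage I m D i = (matrix_inv (reg_gram I m D) *v fst (D i)) \<bullet> fst (D i)"

lemma reg_gram_mult_vec:
  "reg_gram I m D *v w = (\<Sum>i\<in>I. (fst (D i) \<bullet> w) *\<^sub>R fst (D i)) + m *\<^sub>R w"
  by (simp add: reg_gram_def matrix_vector_mult_add_rdistrib sum_matrix_mult_vec outer_mult_vec
      mat_mult_vec)

lemma reg_gram_sym: "v \<bullet> (reg_gram I m D *v w) = (reg_gram I m D *v v) \<bullet> w"
  by (simp add: reg_gram_mult_vec inner_add_left inner_add_right inner_sum_left inner_sum_right
      inner_commute mult_ac)

lemma reg_gram_quadratic:
  "w \<bullet> (reg_gram I m D *v w) = (\<Sum>i\<in>I. (fst (D i) \<bullet> w)\<^sup>2) + m * (norm w)\<^sup>2"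
  by (simp add: reg_gram_mult_vec inner_add_right inner_sum_right dot_square_norm
      inner_commute) (simp add: power2_eq_square)

lemma invertible_reg_gram:
  fixes D :: "'i \<Rightarrow> ('d::finite) obs"
  assumes "m > 0" shows "invertible (reg_gram I m D)"
proof (rule invertible_of_pos_def)
  fix x :: "real ^ 'd" assume "x \<noteq> 0"
  have "(\<Sum>i\<in>I. (fst (D i) \<bullet> x)\<^sup>2) \<ge> 0" by (rule sum_nonneg) simp
  moreover have "m * (norm x)\<^sup>2 > 0" using assms \<open>x \<noteq> 0\<close> by simp
  ultimately show "x \<bullet> (reg_gram I m D *v x) > 0" by (simp add: reg_gram_quadratic)
qed

text \<open>Both bounds follow from \<open>h\<^sup>2 \<le> h\<close>, which holds because \<open>h = \<langle>g, A g\<rangle>\<close> for \<open>g = A\<^sup>-\<^sup>1 X\<^sub>i\<close> and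
  \<open>X\<^sub>i X\<^sub>i\<^sup>T\<close> is one of the positive semidefinite summands of \<open>A\<close>.\<close>

lemma leverage_bounds:
  assumes "finite I" "i \<in> I" "m > 0"
  shows "0 \<le> leverage I m D i" and "leverage I m D i \<le> 1"
proof -
  let ?g = "matrix_inv (reg_gram I m D) *v fst (D i)"
  let ?h = "leverage I m D i"
  have "?h = ?g \<bullet> (reg_gram I m D *v ?g)"
    by (simp add: leverage_def matrix_inv_mult_cancel[OF invertible_reg_gram[OF \<open>m > 0\<close>]])
  also have "\<dots> \<ge> (fst (D i) \<bullet> ?g)\<^sup>2"
    unfolding reg_gram_quadratic using assms
      member_le_sum[of i I "\<lambda>j. (fst (D j) \<bullet> ?g)\<^sup>2"] by (simp add: add_increasing2)
  also have "fst (D i) \<bullet> ?g = ?h" by (simp add: leverage_def inner_commute)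
  finally have h: "?h\<^sup>2 \<le> ?h" .
  show "0 \<le> ?h" using h zero_le_power2[of ?h] by linarith
  then show "?h \<le> 1" using h by (cases "?h = 0") (auto simp: power2_eq_square)
qed

lemma sum_leverage:
  fixes D :: "'i \<Rightarrow> ('d::finite) obs"
  assumes "m > 0"
  shows "(\<Sum>i\<in>I. leverage I m D i) = real CARD('d)
    - m * (\<Sum>k\<in>UNIV. (matrix_inv (reg_gram I m D) *v axis k 1) \<bullet> axis k 1)"
proof -
  let ?B = "matrix_inv (reg_gram I m D)"
  have tr_sum: "trace (?B ** (\<Sum>i\<in>J. S i)) = (\<Sum>i\<in>J. trace (?B ** S i))"
    for J and S :: "'i \<Rightarrow> real ^ 'd ^ 'd"
    by (induction J rule: infinite_finite_induct)
      (simp_all add: matrix_add_ldistrib trace_add trace_0[unfolded mat_0])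
  have "(\<Sum>i\<in>I. leverage I m D i) = trace (?B ** (\<Sum>i\<in>I. outer (fst (D i))))"
    by (simp add: leverage_def tr_sum trace_mult_outer)
  then show ?thesis
    using trace_matrix_inv_mult[OF invertible_reg_gram[OF assms, of I D, unfolded reg_gram_def]]
    by (simp add: reg_gram_def)
qed

text \<open>The quadratic form of the inverse lies above affine functions of the matrix, with equality for
  \<open>w = A\<^sup>-\<^sup>1 e\<close>: the difference is the value of the form of \<open>A\<close> at \<open>A\<^sup>-\<^sup>1 e - w\<close>.\<close>

lemma inverse_quadratic_ge:
  assumes "m > 0"
  shows "(matrix_inv (reg_gram I m D) *v e) \<bullet> e \<ge> 2 * (e \<bullet> w) - w \<bullet> (reg_gram I m D *v w)"
proof -
  let ?A = "reg_gram I m D" and ?u = "matrix_inv (reg_gram I m D) *v e"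
  have Au: "?A *v ?u = e" by (rule matrix_inv_mult_cancel(1)[OF invertible_reg_gram[OF assms]])
  have "0 \<le> (?u - w) \<bullet> (?A *v (?u - w))"
    unfolding reg_gram_quadratic using assms by (intro add_nonneg_nonneg sum_nonneg) auto
  also have "\<dots> = ?u \<bullet> e - ?u \<bullet> (?A *v w) - w \<bullet> e + w \<bullet> (?A *v w)"
    by (simp add: matrix_vector_mult_diff_distrib Au inner_diff_left inner_diff_right)
  also have "?u \<bullet> (?A *v w) = e \<bullet> w" by (simp add: reg_gram_sym Au)
  finally show ?thesis by (simp add: inner_commute)
qed

lemma ridge_normal_equation:
  assumes "n \<ge> 1" "\<mu> > 0"
  shows "reg_gram {1..n} (\<mu> * real n) D *v ridge n \<mu> D = (\<Sum>i=1..n. snd (D i) *\<^sub>R fst (D i))"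
proof -
  let ?A = "emp_second_moment n D + mat \<mu>"
  have "?A *v ridge n \<mu> D = (1 / real n) *\<^sub>R (\<Sum>i=1..n. snd (D i) *\<^sub>R fst (D i))"
    unfolding ridge_closed_form(2)[OF assms(2)]
    by (rule matrix_inv_mult_cancel(1)[OF ridge_closed_form(1)[OF assms(2)]])
  then have "real n *\<^sub>R (?A *v ridge n \<mu> D) = (\<Sum>i=1..n. snd (D i) *\<^sub>R fst (D i))"
    using assms(1) by simp
  moreover have "real n *\<^sub>R (?A *v w) = reg_gram {1..n} (\<mu> * real n) D *v w" for w
    using assms(1) by (simp add: reg_gram_mult_vec matrix_vector_mult_add_rdistrib
        emp_second_moment_mult_vec mat_mult_vec scaleR_add_right mult_ac)
  ultimately show ?thesis by simp
qed

lemma ridge_minimizes: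
  assumes "n \<ge> 1" "\<mu> > 0"
  shows "(\<Sum>i=1..n. (ridge n \<mu> D \<bullet> fst (D i) - snd (D i))\<^sup>2)
    \<le> (\<Sum>i=1..n. (\<theta> \<bullet> fst (D i) - snd (D i))\<^sup>2) + \<mu> * real n * (norm \<theta>)\<^sup>2"
proof -
  have "emp_risk n D (ridge n \<mu> D) + \<mu> * (norm (ridge n \<mu> D))\<^sup>2 \<le> emp_risk n D \<theta> + \<mu> * (norm \<theta>)\<^sup>2"
    using ridge_closed_form(3)[OF assms(2), of \<theta> n D] by fastforce
  moreover have "\<mu> * (norm (ridge n \<mu> D))\<^sup>2 \<ge> 0" using assms by simp
  ultimately have "emp_risk n D (ridge n \<mu> D) \<le> emp_risk n D \<theta> + \<mu> * (norm \<theta>)\<^sup>2" by linarith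
  then show ?thesis using assms(1) by (simp add: emp_risk_def field_simps)
qed

section \<open>Leave-one-out residuals\<close>

text \<open>A sample of \<open>n + 1\<close> observations with the observations \<open>i\<close> and \<open>n + 1\<close> exchanged, so that an
  estimator, which only uses the positions \<open>1, \<dots>, n\<close>, is trained without the original
  observation \<open>i\<close>.\<close>

abbreviation hold_out :: "nat \<Rightarrow> nat \<Rightarrow> (nat \<Rightarrow> 'a) \<Rightarrow> nat \<Rightarrow> 'a" where
  "hold_out n i D \<equiv> D \<circ> Transposition.transpose i (Suc n)"

lemma image_transpose_last:
  assumes "i \<in> {1..Suc n}"
  shows "Transposition.transpose i (Suc n) ` {1..n} = {1..Suc n} - {i}"
proof -
  have "{1..n} = {1..Suc n} - {Suc n}" by auto
  then have "Transposition.transpose i (Suc n) ` {1..n}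
      = Transposition.transpose i (Suc n) ` {1..Suc n} - Transposition.transpose i (Suc n) ` {Suc n}"
    by (metis image_set_diff inj_transpose)
  then show ?thesis using assms by simp
qed

lemma sum_hold_out:
  fixes f :: "'a \<Rightarrow> 'b::ab_group_add"
  assumes "i \<in> {1..Suc n}"
  shows "(\<Sum>j=1..n. f (hold_out n i D j)) = (\<Sum>j=1..Suc n. f (D j)) - f (D i)"
proof -
  let ?t = "Transposition.transpose i (Suc n)"
  have "(\<Sum>j=1..n. f (hold_out n i D j)) = (\<Sum>j\<in>?t ` {1..n}. f (D j))"
    by (subst sum.reindex) (auto intro: inj_on_subset[OF inj_transpose])
  also have "\<dots> = (\<Sum>j=1..Suc n. f (D j)) - f (D i)"
    unfolding image_transpose_last[OF assms] using assms by (subst sum_diff1) auto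
  finally show ?thesis .
qed

lemma adj_lambda_pos: "l > 0 \<Longrightarrow> adj_lambda n l > 0"
  by (simp add: adj_lambda_def add_pos_nonneg)

lemma adj_lambda_mult: "n \<ge> 1 \<Longrightarrow> adj_lambda n l * real n = l * real (Suc n)"
  by (simp add: adj_lambda_def field_simps)

lemma ridge_leverage_hold_out:
  assumes "n \<ge> 1" "i \<in> {1..Suc n}"
  shows "ridge_leverage n (adj_lambda n l) (hold_out n i D) (fst (D i))
    = leverage {1..Suc n} (l * real (Suc n)) D i"
proof -
  have "(\<Sum>j=1..n. outer (fst (hold_out n i D j))) + mat (l * real (Suc n)) + outer (fst (D i))
      = reg_gram {1..Suc n} (l * real (Suc n)) D"
    unfolding sum_hold_out[OF assms(2), where f = "\<lambda>z. outer (fst z)"] reg_gram_def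
    by (simp only: algebra_simps)
  then show ?thesis
    unfolding ridge_leverage_def leverage_def adj_lambda_mult[OF assms(1)] by (rule arg_cong)
qed

text \<open>Adding back the held-out observation to its normal equation shows that the two ridge estimators
  differ by a multiple of \<open>A\<^sup>-\<^sup>1 X\<^sub>i\<close>.\<close>

lemma hold_out_residual:
  fixes D :: "nat \<Rightarrow> ('d::finite) obs"
  assumes "n \<ge> 1" "l > 0" "i \<in> {1..Suc n}"
  shows "(ridge n (adj_lambda n l) (hold_out n i D) \<bullet> fst (D i) - snd (D i))
      * (1 - leverage {1..Suc n} (l * real (Suc n)) D i)
    = ridge (Suc n) l D \<bullet> fst (D i) - snd (D i)"
proof -
  define m where "m = l * real (Suc n)"
  have m: "m > 0" using assms by (simp add: m_def)
  define A where "A = reg_gram {1..Suc n} m D"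
  note inv = matrix_inv_mult_cancel[OF invertible_reg_gram[OF m], of "{1..Suc n}" D, folded A_def]
  define t where "t = ridge n (adj_lambda n l) (hold_out n i D)"
  define t0 where "t0 = ridge (Suc n) l D"
  define x y where "x = fst (D i)" and "y = snd (D i)"
  have t0: "A *v t0 = (\<Sum>j=1..Suc n. snd (D j) *\<^sub>R fst (D j))"
    using ridge_normal_equation[of "Suc n" l D] assms by (simp add: A_def m_def t0_def)
  have "reg_gram {1..n} m (hold_out n i D) *v t = A *v t0 - y *\<^sub>R x"
    using ridge_normal_equation[OF assms(1) adj_lambda_pos[OF assms(2), of n], of "hold_out n i D"]
    unfolding adj_lambda_mult[OF assms(1)]
      sum_hold_out[OF assms(3), where f = "\<lambda>z. snd z *\<^sub>R fst z"]
    by (simp add: t_def m_def t0 x_def y_def)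
  moreover have "reg_gram {1..n} m (hold_out n i D) *v t = A *v t - (x \<bullet> t) *\<^sub>R x"
    unfolding A_def reg_gram_mult_vec
      sum_hold_out[OF assms(3), where f = "\<lambda>z. (fst z \<bullet> t) *\<^sub>R fst z"]
    by (simp add: x_def)
  ultimately have "A *v t0 - y *\<^sub>R x = A *v t - (x \<bullet> t) *\<^sub>R x" by simp
  then have "A *v (t - t0) = (x \<bullet> t - y) *\<^sub>R x"
    by (simp add: matrix_vector_mult_diff_distrib algebra_simps)
  then have "t - t0 = (x \<bullet> t - y) *\<^sub>R (matrix_inv A *v x)"
    by (metis inv(2) matrix_vector_mult_scaleR)
  then have "(t - t0) \<bullet> x = (x \<bullet> t - y) * leverage {1..Suc n} m D i"
    by (simp add: leverage_def A_def x_def)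
  then show ?thesis
    unfolding t_def[symmetric] t0_def[symmetric] m_def[symmetric] x_def[symmetric] y_def[symmetric]
    by (simp add: inner_diff_left inner_commute algebra_simps)
qed

section \<open>Pointwise error bounds\<close>

lemma fw_error_bound:
  fixes p y h r :: real
  assumes pr: "(p - y) * (1 - h) = r" and h: "0 \<le> h" "h \<le> 1"
  shows "((1 - h)\<^sup>2 * p - y)\<^sup>2 \<le> r\<^sup>2 + 2 * h * y\<^sup>2"
proof -
  have e: "(1 - h)\<^sup>2 * p - y = (1 - h) * r - h * (2 - h) * y"
    unfolding pr[symmetric] by (simp add: power2_eq_square algebra_simps)
  \<comment> \<open>Completing the square in \<open>r\<close> leaves the term \<open>h\<^sup>2 y\<^sup>2\<close> to spare.\<close>
  have "r\<^sup>2 + 2 * h * y\<^sup>2 - ((1 - h)\<^sup>2 * p - y)\<^sup>2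
      = h * ((2 - h) * (r + (1 - h) * y)\<^sup>2 + h * y\<^sup>2)"
    unfolding e by (simp add: power2_eq_square algebra_simps)
  moreover have "h * ((2 - h) * (r + (1 - h) * y)\<^sup>2 + h * y\<^sup>2) \<ge> 0"
    using h by (intro mult_nonneg_nonneg add_nonneg_nonneg) auto
  ultimately show ?thesis by linarith
qed

text \<open>If \<open>\<bar>y\<bar> \<le> a\<close>, truncation at \<open>a\<close> can only decrease the error, which is also at most \<open>2 b\<close>. If
  \<open>\<bar>y\<bar> > a\<close>, it increases the error only when the prediction is truncated on the side of \<open>y\<close>, and
  then the error is \<open>\<bar>y\<bar> - a \<le> b\<close>.\<close>

lemma trunc_error_bound:
  fixes p y h r a b :: real
  assumes pr: "(p - y) * (1 - h) = r" and h: "0 \<le> h" "h \<le> 1"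
    and a: "0 \<le> a" "a \<le> b" and y: "\<bar>y\<bar> \<le> b"
  shows "(trunc a p - y)\<^sup>2 \<le> r\<^sup>2 + 8 * b\<^sup>2 * h + (if \<bar>y\<bar> > a then b\<^sup>2 else 0)"
proof -
  define e where "e = trunc a p - y"
  have alt: "\<bar>e\<bar> \<le> \<bar>p - y\<bar> \<or> (\<bar>y\<bar> > a \<and> \<bar>e\<bar> \<le> b)" and e2: "\<bar>e\<bar> \<le> 2 * b"
    using a y unfolding e_def trunc_def by linarith+
  have nn: "8 * b\<^sup>2 * h \<ge> 0" using h by simp
  show ?thesis
  proof (cases "\<bar>e\<bar> \<le> \<bar>p - y\<bar>")
    case True
    have "(1 - h)\<^sup>2 * e\<^sup>2 \<le> (1 - h)\<^sup>2 * (p - y)\<^sup>2"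
      using True by (intro mult_left_mono) (auto simp: abs_le_square_iff)
    also have "\<dots> = r\<^sup>2" using pr by (simp add: power_mult_distrib[symmetric] mult.commute)
    finally have "e\<^sup>2 - r\<^sup>2 \<le> h * (2 - h) * e\<^sup>2" by (simp add: power2_eq_square algebra_simps)
    also have "h * (2 - h) * e\<^sup>2 \<le> (h * 2) * (4 * b\<^sup>2)"
    proof (intro mult_mono)
      show "e\<^sup>2 \<le> 4 * b\<^sup>2" using e2 a power_mono[of "\<bar>e\<bar>" "2 * b" 2] by (simp add: power_mult_distrib)
    qed (use h in auto)
    finally have "e\<^sup>2 \<le> r\<^sup>2 + 8 * b\<^sup>2 * h" by (simp add: mult_ac)
    then show ?thesis unfolding e_def by (auto intro: order_trans)
  next
    case False
    then have "\<bar>y\<bar> > a" "\<bar>e\<bar> \<le> b" using alt by auto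
    moreover from this have "e\<^sup>2 \<le> b\<^sup>2" using power_mono[of "\<bar>e\<bar>" b 2] by simp
    ultimately show ?thesis using nn unfolding e_def[symmetric] by (simp add: add_increasing)
  qed
qed

section \<open>Measurability of the ridge estimator\<close>

lemma borel_measurable_det:
  fixes A :: "'a \<Rightarrow> real ^ 'd ^ 'd"
  assumes [measurable]: "\<And>i j. (\<lambda>x. A x $ i $ j) \<in> borel_measurable M"
  shows "(\<lambda>x. det (A x)) \<in> borel_measurable M"
  unfolding det_def by measurable

text \<open>By Cramer's rule, the solution of a linear system is a quotient of determinants.\<close>

lemma borel_measurable_matrix_inv_mult:
  fixes A :: "'a \<Rightarrow> real ^ 'd ^ 'd"
  assumes inv: "\<And>x. invertible (A x)"
    and [measurable]: "\<And>i j. (\<lambda>x. A x $ i $ j) \<in> borel_measurable M"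
      "\<And>i. (\<lambda>x. v x $ i) \<in> borel_measurable M"
  shows "(\<lambda>x. (matrix_inv (A x) *v v x) $ k) \<in> borel_measurable M"
proof -
  have "(matrix_inv (A x) *v v x) $ k
      = det (\<chi> i j. if j = k then v x $ i else A x $ i $ j) / det (A x)" for x
    using cramer[of "A x" "matrix_inv (A x) *v v x" "v x"] inv[of x]
    by (simp add: matrix_inv_mult_cancel invertible_det_nz)
  moreover have "(\<lambda>x. det (\<chi> i j. if j = k then v x $ i else A x $ i $ j)) \<in> borel_measurable M"
  proof (rule borel_measurable_det)
    fix i j show "(\<lambda>x. (\<chi> i j. if j = k then v x $ i else A x $ i $ j) $ i $ j) \<in> borel_measurable M"
      by (cases "j = k") simp_all
  qed
  moreover have "(\<lambda>x. det (A x)) \<in> borel_measurable M"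
    by (rule borel_measurable_det) simp
  ultimately show ?thesis by simp
qed

lemma borel_measurable_inner_vec:
  fixes u v :: "'a \<Rightarrow> real ^ 'd"
  assumes "\<And>k. (\<lambda>x. u x $ k) \<in> borel_measurable M" "\<And>k. (\<lambda>x. v x $ k) \<in> borel_measurable M"
  shows "(\<lambda>x. u x \<bullet> v x) \<in> borel_measurable M"
  unfolding inner_vec_def using assms by simp

lemma measurable_obs [measurable]:
  assumes "i \<in> I"
  shows "(\<lambda>D. fst (D i) $ k) \<in> borel_measurable (Pi\<^sub>M I (\<lambda>_. borel :: ('d::finite) obs measure))"
    and "(\<lambda>D. snd (D i)) \<in> borel_measurable (Pi\<^sub>M I (\<lambda>_. borel :: 'd obs measure))"
proof -
  have c: "(\<lambda>D. D i) \<in> measurable (Pi\<^sub>M I (\<lambda>_. borel)) (borel :: 'd obs measure)"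
    using assms by measurable
  have "(\<lambda>z :: 'd obs. fst z $ k) \<in> borel_measurable borel"
    by (intro borel_measurable_continuous_onI continuous_intros)
  from measurable_compose[OF c this]
  show "(\<lambda>D. fst (D i) $ k) \<in> borel_measurable (Pi\<^sub>M I (\<lambda>_. borel :: 'd obs measure))" .
  have "(\<lambda>z :: 'd obs. snd z) \<in> borel_measurable borel"
    by (intro borel_measurable_continuous_onI continuous_intros)
  from measurable_compose[OF c this]
  show "(\<lambda>D. snd (D i)) \<in> borel_measurable (Pi\<^sub>M I (\<lambda>_. borel :: 'd obs measure))" .
qed

lemma mat_entry: "(mat c :: real ^ 'd ^ 'd) $ i $ j = (if i = j then c else 0)"
  by (simp add: mat_def)

lemma borel_measurable_ridge_pred:
  assumes "\<mu> > 0" "{1..n} \<subseteq> I" "j \<in> I"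
  shows "(\<lambda>D. ridge n \<mu> D \<bullet> fst (D j))
    \<in> borel_measurable (Pi\<^sub>M I (\<lambda>_. borel :: ('d::finite) obs measure))"
proof (rule borel_measurable_inner_vec)
  fix k
  have [simp]: "i \<in> I" if "Suc 0 \<le> i" "i \<le> n" for i using that assms by auto
  show "(\<lambda>D. ridge n \<mu> D $ k) \<in> borel_measurable (Pi\<^sub>M I (\<lambda>_. borel :: 'd obs measure))"
    unfolding ridge_closed_form(2)[OF assms(1)]
    by (intro borel_measurable_matrix_inv_mult ridge_closed_form(1)[OF assms(1)])
      (simp_all add: emp_second_moment_def outer_def mat_entry)
  show "(\<lambda>D. fst (D j) $ k) \<in> borel_measurable (Pi\<^sub>M I (\<lambda>_. borel :: 'd obs measure))"
    using assms(3) by (rule measurable_obs)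
qed

lemma borel_measurable_ridge_leverage:
  assumes "\<mu> > 0" "n \<ge> 1" "{1..n} \<subseteq> I" "j \<in> I"
  shows "(\<lambda>D. ridge_leverage n \<mu> D (fst (D j)))
    \<in> borel_measurable (Pi\<^sub>M I (\<lambda>_. borel :: ('d::finite) obs measure))"
proof -
  have [simp]: "i \<in> I" if "Suc 0 \<le> i" "i \<le> n" for i using that assms by auto
  have inv: "invertible ((\<Sum>i=1..n. outer (fst (D i))) + mat (\<mu> * real n) + outer (x :: real ^ 'd))" for D :: "nat \<Rightarrow> 'd obs" and x
  proof -
    \<comment> \<open>The matrix is the regularized Gram matrix of the sample extended by \<open>x\<close>.\<close>
    let ?D = "\<lambda>i. if i = Suc n then (x, 0) else D i"
    have eq: "(\<Sum>i=1..n. outer (fst (D i))) + mat (\<mu> * real n) + outer x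
       = reg_gram {1..Suc n} (\<mu> * real n) ?D"
      by (simp add: reg_gram_def algebra_simps)
    show ?thesis unfolding eq by (rule invertible_reg_gram) (use assms in simp)
  qed
  show ?thesis
    unfolding ridge_leverage_def
    using assms by (intro borel_measurable_inner_vec borel_measurable_matrix_inv_mult inv)
      (simp_all add: outer_def mat_entry)
qed

section \<open>Samples from a distribution with bounded labels\<close>

lemma ennreal_le_INF_addI:
  fixes a :: ennreal
  assumes "\<And>i. i \<in> I \<Longrightarrow> a \<le> f i + ennreal k"
  shows "a \<le> (INF i\<in>I. f i) + ennreal k"
proof -
  have "a - ennreal k \<le> (INF i\<in>I. f i)"
    by (rule INF_greatest) (use assms in \<open>simp add: ennreal_minus_le_iff add.commute\<close>)
  then show ?thesis by (simp add: ennreal_minus_le_iff add.commute)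
qed

text \<open>Index sets \<open>{1..N}\<close> should keep this form under simplification.\<close>

declare One_nat_def [simp del]

text \<open>A distribution \<open>P\<close> of pairs \<open>(X, Y)\<close> with \<open>\<bar>Y\<bar> \<le> b\<close> almost surely and finite second moment
  of \<open>X\<close>.\<close>

locale bounded_label_distribution =
  fixes P :: "('d::finite) obs measure" and b :: real
  assumes prob_P: "prob_space P" and sets_P: "sets P = sets borel"
    and bounded_label: "AE z in P. \<bar>snd z\<bar> \<le> b"
    and second_moment_exists: "integrable P (\<lambda>z. outer (fst z))"
begin

lemma borel_measurable_P: "borel_measurable P = borel_measurable borel"
  by (rule measurable_cong_sets) (simp_all add: sets_P)

lemma measurable_obs_P:
  shows "(\<lambda>z. w \<bullet> fst z) \<in> borel_measurable P" and "snd \<in> borel_measurable P"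
  unfolding borel_measurable_P by (intro borel_measurable_continuous_onI continuous_intros)+

lemma second_moment_quadratic:
  shows "integrable P (\<lambda>z. (fst z \<bullet> w)\<^sup>2)"
    and "(\<integral>z. (fst z \<bullet> w)\<^sup>2 \<partial>P) = w \<bullet> (second_moment P *v w)"
proof -
  have "linear (\<lambda>S :: real ^ 'd ^ 'd. w \<bullet> (S *v w))"
    by (rule linearI) (simp_all add: matrix_vector_mult_add_rdistrib inner_add_right
        scaleR_matrix_vector_assoc[symmetric])
  then have bl: "bounded_linear (\<lambda>S :: real ^ 'd ^ 'd. w \<bullet> (S *v w))"
    by (simp add: linear_conv_bounded_linear)
  have q: "w \<bullet> (outer x *v w) = (x \<bullet> w)\<^sup>2" for x
    by (simp add: outer_mult_vec inner_commute power2_eq_square)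
  show "integrable P (\<lambda>z. (fst z \<bullet> w)\<^sup>2)"
    using integrable_bounded_linear[OF bl second_moment_exists] by (simp add: q)
  show "(\<integral>z. (fst z \<bullet> w)\<^sup>2 \<partial>P) = w \<bullet> (second_moment P *v w)"
    using integral_bounded_linear[OF bl second_moment_exists] by (simp add: q second_moment_def)
qed

lemma integrable_sq_loss: "integrable P (\<lambda>z. (\<theta> \<bullet> fst z - snd z)\<^sup>2)"
proof (rule Bochner_Integration.integrable_bound)
  interpret prob_space P by (rule prob_P)
  show "integrable P (\<lambda>z. 2 * (fst z \<bullet> \<theta>)\<^sup>2 + 2 * b\<^sup>2)"
    by (simp add: second_moment_quadratic)
  show "(\<lambda>z. (\<theta> \<bullet> fst z - snd z)\<^sup>2) \<in> borel_measurable P"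
    by (intro borel_measurable_power borel_measurable_diff measurable_obs_P)
  show "AE z in P. norm ((\<theta> \<bullet> fst z - snd z)\<^sup>2) \<le> norm (2 * (fst z \<bullet> \<theta>)\<^sup>2 + 2 * b\<^sup>2)"
    using bounded_label
  proof eventually_elim
    case (elim z)
    have "(\<theta> \<bullet> fst z - snd z)\<^sup>2 \<le> 2 * (fst z \<bullet> \<theta>)\<^sup>2 + 2 * (snd z)\<^sup>2"
      using zero_le_power2[of "fst z \<bullet> \<theta> + snd z"]
      by (simp add: power2_eq_square inner_commute algebra_simps)
    moreover have "(snd z)\<^sup>2 \<le> b\<^sup>2" using power_mono[OF elim, of 2] by simp
    ultimately show ?case by simp
  qed
qed

lemma risk_lin_pred: "risk P (lin_pred \<theta>) = ennreal (\<integral>z. (\<theta> \<bullet> fst z - snd z)\<^sup>2 \<partial>P)"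
  unfolding risk_def lin_pred_def by (intro nn_integral_eq_integral integrable_sq_loss) simp

lemma invertible_second_moment_add:
  assumes "l > 0" shows "invertible (second_moment P + mat l)"
proof (rule invertible_of_pos_def)
  fix x :: "real ^ 'd" assume "x \<noteq> 0"
  have "x \<bullet> (second_moment P *v x) \<ge> 0"
    unfolding second_moment_quadratic(2)[symmetric] by simp
  moreover have "l * (x \<bullet> x) > 0" using assms \<open>x \<noteq> 0\<close> by simp
  ultimately show "x \<bullet> ((second_moment P + mat l) *v x) > 0"
    by (simp add: matrix_vector_mult_add_rdistrib mat_mult_vec inner_add_right)
qed

text \<open>The law of an independent sample indexed by \<open>I\<close>.\<close>

abbreviation sample_measure :: "nat set \<Rightarrow> (nat \<Rightarrow> 'd obs) measure" where
  "sample_measure I \<equiv> Pi\<^sub>M I (\<lambda>_. P)"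

lemma prob_space_sample: "prob_space (sample_measure I)"
  by (rule prob_space_PiM) (rule prob_P)

lemma sample_const [simp]:
  "integrable (sample_measure I) (\<lambda>_. a :: real)"
  "measure (sample_measure I) (space (sample_measure I)) = 1"
  by (simp_all add: prob_space.prob_space[OF prob_space_sample]
      finite_measure.integrable_const[OF prob_space.finite_measure[OF prob_space_sample]])

lemma borel_measurable_sample:
  "borel_measurable (sample_measure I) = borel_measurable (Pi\<^sub>M I (\<lambda>_. borel))"
  by (rule measurable_cong_sets) (simp_all add: sets_P cong: sets_PiM_cong)

lemma sample_component:
  fixes \<phi> :: "'d obs \<Rightarrow> real"
  assumes "i \<in> I" "integrable P \<phi>"
  shows "integrable (sample_measure I) (\<lambda>D. \<phi> (D i))"
    and "(\<integral>D. \<phi> (D i) \<partial>sample_measure I) = (\<integral>z. \<phi> z \<partial>P)"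
proof -
  have d: "distr (sample_measure I) P (\<lambda>D. D i) = P"
    using distr_PiM_component[of I "\<lambda>_. P" i] prob_P assms(1) by simp
  have m: "(\<lambda>D. D i) \<in> measurable (sample_measure I) P" using assms(1) by simp
  show "integrable (sample_measure I) (\<lambda>D. \<phi> (D i))"
    by (rule integrable_distr[OF m]) (simp add: d assms(2))
  show "(\<integral>D. \<phi> (D i) \<partial>sample_measure I) = (\<integral>z. \<phi> z \<partial>P)"
    using integral_distr[OF m, of \<phi>] assms(2) by (simp add: d borel_measurable_integrable)
qed

lemma AE_sample_bounded:
  assumes "finite I"
  shows "AE D in sample_measure I. \<forall>i\<in>I. \<bar>snd (D i)\<bar> \<le> b"
proof (subst AE_finite_all[OF assms], intro ballI)
  fix i assume "i \<in> I"
  then show "AE D in sample_measure I. \<bar>snd (D i)\<bar> \<le> b"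
    using AE_PiM_component[of I "\<lambda>_. P" i "\<lambda>z. \<bar>snd z\<bar> \<le> b"] prob_P bounded_label by simp
qed

text \<open>The affine function of the empirical Gram matrix that supports the concave function
  \<open>\<Sum>i\<le>N. h\<^sub>i = d - l N Tr(A\<^sup>-\<^sup>1)\<close> of \<open>A\<close> at the expected matrix \<open>N (\<Sigma> + l I)\<close>; here
  \<open>w = (\<Sigma> + l I)\<^sup>-\<^sup>1 e / N\<close> for each basis vector \<open>e\<close>.\<close>

definition leverage_majorant :: "nat \<Rightarrow> real \<Rightarrow> (nat \<Rightarrow> 'd obs) \<Rightarrow> real" where
  "leverage_majorant N l D = real CARD('d) - l * real N * (\<Sum>k\<in>UNIV.
     let w = (1 / real N) *\<^sub>R (matrix_inv (second_moment P + mat l) *v axis k 1)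
     in 2 * (axis k 1 \<bullet> w) - w \<bullet> (reg_gram {1..N} (l * real N) D *v w))"

lemma sum_leverage_le_majorant:
  assumes "N \<ge> 1" "l > 0"
  shows "(\<Sum>i=1..N. leverage {1..N} (l * real N) D i) \<le> leverage_majorant N l D"
proof -
  have m: "l * real N > 0" using assms by simp
  show ?thesis
    unfolding sum_leverage[OF m] leverage_majorant_def Let_def using m
    by (intro diff_left_mono mult_left_mono sum_mono inverse_quadratic_ge) auto
qed

lemma expectation_leverage_majorant:
  assumes N: "N \<ge> 1" and l: "l > 0"
  shows "integrable (sample_measure {1..N}) (leverage_majorant N l)"
    and "(\<integral>D. leverage_majorant N l D \<partial>sample_measure {1..N}) = deg_freedom P l"
proof -
  let ?Q = "sample_measure {1..N}"
  interpret Q: prob_space ?Q by (rule prob_space_sample)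
  define C where "C = second_moment P + mat l"
  have C_inv: "invertible C" unfolding C_def by (rule invertible_second_moment_add[OF l])
  have quad: "integrable ?Q (\<lambda>D. w \<bullet> (reg_gram {1..N} (l * real N) D *v w))"
    "(\<integral>D. w \<bullet> (reg_gram {1..N} (l * real N) D *v w) \<partial>?Q) = real N * (w \<bullet> (C *v w))" for w
  proof -
    have i: "integrable ?Q (\<lambda>D. (fst (D i) \<bullet> w)\<^sup>2)"
      "(\<integral>D. (fst (D i) \<bullet> w)\<^sup>2 \<partial>?Q) = w \<bullet> (second_moment P *v w)" if "i \<in> {1..N}" for i
      using sample_component[OF that second_moment_quadratic(1)] second_moment_quadratic(2) by auto
    show "integrable ?Q (\<lambda>D. w \<bullet> (reg_gram {1..N} (l * real N) D *v w))"
      unfolding reg_gram_quadratic using i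
      by (intro Bochner_Integration.integrable_add Bochner_Integration.integrable_sum) auto
    have "(\<integral>D. w \<bullet> (reg_gram {1..N} (l * real N) D *v w) \<partial>?Q)
        = (\<Sum>i\<in>{1..N}. w \<bullet> (second_moment P *v w)) + l * real N * (norm w)\<^sup>2"
      unfolding reg_gram_quadratic using i
      by (subst Bochner_Integration.integral_add)
        (auto intro!: Bochner_Integration.integrable_sum simp: Bochner_Integration.integral_sum Q.prob_space)
    then show "(\<integral>D. w \<bullet> (reg_gram {1..N} (l * real N) D *v w) \<partial>?Q) = real N * (w \<bullet> (C *v w))"
      by (simp add: C_def matrix_vector_mult_add_rdistrib mat_mult_vec inner_add_right
          dot_square_norm algebra_simps)
  qed
  define w where "w k = (1 / real N) *\<^sub>R (matrix_inv C *v axis k 1)" for k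
  have maj: "leverage_majorant N l = (\<lambda>D. real CARD('d) - l * real N * (\<Sum>k\<in>UNIV.
      2 * (axis k 1 \<bullet> w k) - w k \<bullet> (reg_gram {1..N} (l * real N) D *v w k)))"
    by (simp add: fun_eq_iff leverage_majorant_def Let_def w_def C_def)
  have int_k: "integrable ?Q (\<lambda>D. 2 * (axis k 1 \<bullet> w k)
      - w k \<bullet> (reg_gram {1..N} (l * real N) D *v w k))" for k
    using quad(1) by simp
  have eq_k: "(\<integral>D. 2 * (axis k 1 \<bullet> w k) - w k \<bullet> (reg_gram {1..N} (l * real N) D *v w k) \<partial>?Q)
      = (matrix_inv C *v axis k 1) \<bullet> axis k 1 / real N" for k
  proof -
    have "w k \<bullet> (C *v w k) = (matrix_inv C *v axis k 1) \<bullet> axis k 1 / (real N)\<^sup>2"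
      by (simp add: w_def matrix_vector_mult_scaleR matrix_inv_mult_cancel[OF C_inv]
          power2_eq_square)
    then show ?thesis
      using N quad by (simp add: Q.prob_space) (simp add: w_def inner_commute power2_eq_square field_simps)
  qed
  have sum_int: "integrable ?Q (\<lambda>D. \<Sum>k\<in>UNIV. 2 * (axis k 1 \<bullet> w k)
      - w k \<bullet> (reg_gram {1..N} (l * real N) D *v w k))"
    by (rule Bochner_Integration.integrable_sum) (rule int_k)
  show "integrable ?Q (leverage_majorant N l)"
    unfolding maj
    by (intro Bochner_Integration.integrable_diff integrable_mult_right sum_int sample_const)
  have "(\<integral>D. leverage_majorant N l D \<partial>?Q)
      = real CARD('d) - l * real N * (\<Sum>k\<in>UNIV. (matrix_inv C *v axis k 1) \<bullet> axis k 1 / real N)"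
    unfolding maj
    by (subst Bochner_Integration.integral_diff)
      (simp_all only: sum_int sample_const integrable_mult_right integral_mult_right_zero
        Bochner_Integration.integral_sum[OF int_k] eq_k lebesgue_integral_const
        real_scaleR_def mult_1)
  also have "\<dots> = deg_freedom P l"
    using N trace_matrix_inv_mult[OF C_inv[unfolded C_def]]
    by (simp add: deg_freedom_def C_def sum_divide_distrib[symmetric])
  finally show "(\<integral>D. leverage_majorant N l D \<partial>?Q) = deg_freedom P l" .
qed

lemma deg_freedom_nonneg:
  assumes "l > 0" shows "deg_freedom P l \<ge> 0"
proof -
  have "0 \<le> leverage_majorant 1 l D" for D
    using sum_leverage_le_majorant[of 1 l D] leverage_bounds(1)[of "{1..1}" 1 l D] assms by simp
  then have "0 \<le> (\<integral>D. leverage_majorant 1 l D \<partial>sample_measure {1..1})"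
    by (rule Bochner_Integration.integral_nonneg)
  then show ?thesis using expectation_leverage_majorant(2)[of 1 l] assms by simp
qed

section \<open>Exchangeability and the expected risk\<close>

lemma nn_integral_hold_out:
  fixes G :: "(nat \<Rightarrow> 'd obs) \<Rightarrow> ennreal"
  assumes i: "i \<in> {1..Suc n}" and G: "G \<in> borel_measurable (sample_measure {1..Suc n})"
  shows "(\<integral>\<^sup>+D. G (hold_out n i D) \<partial>sample_measure {1..Suc n})
    = (\<integral>\<^sup>+D. G D \<partial>sample_measure {1..Suc n})"
    and "(\<lambda>D. G (hold_out n i D)) \<in> borel_measurable (sample_measure {1..Suc n})"
proof -
  let ?Q = "sample_measure {1..Suc n}" and ?t = "Transposition.transpose i (Suc n)"
  let ?T = "\<lambda>D :: nat \<Rightarrow> 'd obs. \<lambda>j\<in>{1..Suc n}. D (?t j)"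
  have tI: "?t j \<in> {1..Suc n} \<longleftrightarrow> j \<in> {1..Suc n}" for j
    using i by (auto simp: Transposition.transpose_def)
  have T: "?T D = hold_out n i D" if "D \<in> space ?Q" for D
  proof
    fix j show "?T D j = hold_out n i D j"
      using that tI[of j] by (auto simp: space_PiM PiE_def extensional_def)
  qed
  have d: "distr ?Q ?Q ?T = ?Q"
    using distr_PiM_reindex[of "{1..Suc n}" "\<lambda>_. P" ?t "{1..Suc n}"] prob_P tI
    by (auto intro: inj_on_subset[OF inj_transpose])
  have mT: "?T \<in> measurable ?Q ?Q"
    using tI by (intro measurable_restrict measurable_component_singleton) auto
  have "(\<integral>\<^sup>+D. G D \<partial>?Q) = (\<integral>\<^sup>+D. G (?T D) \<partial>?Q)"
    by (rule nn_integral_distr[OF mT, of G, unfolded d, OF G])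
  also have "\<dots> = (\<integral>\<^sup>+D. G (hold_out n i D) \<partial>?Q)"
    by (intro nn_integral_cong) (simp only: T)
  finally show "(\<integral>\<^sup>+D. G (hold_out n i D) \<partial>?Q) = (\<integral>\<^sup>+D. G D \<partial>?Q)" by simp
  show "(\<lambda>D. G (hold_out n i D)) \<in> borel_measurable ?Q"
  proof -
    have "(\<lambda>D. G (hold_out n i D)) \<in> borel_measurable ?Q
        \<longleftrightarrow> (\<lambda>D. G (?T D)) \<in> borel_measurable ?Q"
      by (rule measurable_cong) (simp only: T)
    then show ?thesis using measurable_compose[OF mT G] by (simp only:)
  qed
qed

text \<open>The test point becomes observation \<open>n + 1\<close>. The estimator \<open>F\<close> may only look at the positions
  \<open>1, \<dots>, n\<close> of the sample.\<close>

lemma nn_integral_sample_eq_PiM: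
  fixes M :: "'w measure" and Z :: "nat \<Rightarrow> 'w \<Rightarrow> 'd obs"
    and F :: "(nat \<Rightarrow> 'd obs) \<Rightarrow> real ^ 'd \<Rightarrow> real"
  assumes n: "n \<ge> 1"
    and M: "prob_space M"
    and indep: "prob_space.indep_vars M (\<lambda>_. borel) Z {1..n}"
    and distr: "\<And>i. i \<in> {1..n} \<Longrightarrow> distr M borel (Z i) = P"
    and F_cong: "\<And>D D' x. (\<And>i. i \<in> {1..n} \<Longrightarrow> D i = D' i) \<Longrightarrow> F D x = F D' x"
    and F_meas: "(\<lambda>D. F D (fst (D (Suc n)))) \<in> borel_measurable (Pi\<^sub>M {1..Suc n} (\<lambda>_. borel))"
  shows "(\<integral>\<^sup>+\<omega>. risk P (F (\<lambda>i. Z i \<omega>)) \<partial>M)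
    = (\<integral>\<^sup>+D. ennreal ((F D (fst (D (Suc n))) - snd (D (Suc n)))\<^sup>2) \<partial>sample_measure {1..Suc n})"
    and "(\<lambda>D. ennreal ((F D (fst (D (Suc n))) - snd (D (Suc n)))\<^sup>2))
      \<in> borel_measurable (sample_measure {1..Suc n})"
proof -
  interpret M: prob_space M by (rule M)
  interpret P: prob_space P by (rule prob_P)
  interpret PS: product_sigma_finite "\<lambda>_. P" by unfold_locales
  let ?N = "Suc n"
  let ?Q = "sample_measure {1..?N}" and ?Qn = "sample_measure {1..n}"
  let ?X = "\<lambda>\<omega>. \<lambda>i\<in>{1..n}. Z i \<omega>"
  define G where "G D = ennreal ((F D (fst (D ?N)) - snd (D ?N))\<^sup>2)" for D
  have G_meas: "G \<in> borel_measurable ?Q"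
  proof -
    have "(\<lambda>D. (F D (fst (D ?N)) - snd (D ?N))\<^sup>2) \<in> borel_measurable ?Q"
      unfolding borel_measurable_sample
      by (intro borel_measurable_power borel_measurable_diff F_meas measurable_obs(2)) simp
    from measurable_compose[OF this measurable_ennreal] show ?thesis
      by (simp only: G_def[abs_def])
  qed
  then show "(\<lambda>D. ennreal ((F D (fst (D ?N)) - snd (D ?N))\<^sup>2)) \<in> borel_measurable ?Q"
    by (simp add: G_def[abs_def])
  have ins: "{1..?N} = insert ?N {1..n}" by auto
  have G_upd: "G (D(?N := z)) = ennreal ((F D (fst z) - snd z)\<^sup>2)" for D z
    unfolding G_def using F_cong[of "D(?N := z)" D] by simp
  have risk_eq: "risk P (F D) = (\<integral>\<^sup>+z. G (D(?N := z)) \<partial>P)" for D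
    by (simp add: risk_def G_upd)
  have G_meas': "G \<in> borel_measurable (sample_measure (insert ?N {1..n}))"
    using G_meas by (simp add: ins)
  have "(\<lambda>(D, z). G (D(?N := z))) \<in> borel_measurable (?Qn \<Otimes>\<^sub>M P)"
    using measurable_compose[OF measurable_add_dim[of ?N "{1..n}" "\<lambda>_. P"] G_meas']
    by (simp add: split_beta')
  then have risk_meas: "(\<lambda>D. risk P (F D)) \<in> borel_measurable ?Qn"
    unfolding risk_eq by (intro P.borel_measurable_nn_integral) simp
  have rv: "Z i \<in> borel_measurable M" if "i \<in> {1..n}" for i
    using indep that unfolding M.indep_vars_def by auto
  have X_meas: "?X \<in> measurable M (Pi\<^sub>M {1..n} (\<lambda>_. borel))"
    using rv by (intro measurable_restrict) auto
  have "distr M (Pi\<^sub>M {1..n} (\<lambda>_. borel)) ?X = Pi\<^sub>M {1..n} (\<lambda>i. distr M borel (Z i))"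
    using M.indep_vars_iff_distr_eq_PiM'[of "{1..n}" Z "\<lambda>_. borel"] rv indep n by auto
  also have "\<dots> = ?Qn" using distr by (intro PiM_cong) auto
  finally have d: "distr M (Pi\<^sub>M {1..n} (\<lambda>_. borel)) ?X = ?Qn" .
  have "(\<integral>\<^sup>+\<omega>. risk P (F (\<lambda>i. Z i \<omega>)) \<partial>M) = (\<integral>\<^sup>+\<omega>. risk P (F (?X \<omega>)) \<partial>M)"
  proof (rule nn_integral_cong)
    fix \<omega>
    have "F (\<lambda>i. Z i \<omega>) = F (?X \<omega>)" by (rule ext, rule F_cong) simp
    then show "risk P (F (\<lambda>i. Z i \<omega>)) = risk P (F (?X \<omega>))" by simp
  qed
  also have "\<dots> = (\<integral>\<^sup>+D. risk P (F D) \<partial>?Qn)"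
    using nn_integral_distr[OF X_meas, of "\<lambda>D. risk P (F D)"] risk_meas
    by (simp add: d borel_measurable_sample)
  also have "\<dots> = (\<integral>\<^sup>+D. G D \<partial>?Q)"
    unfolding risk_eq ins using PS.product_nn_integral_insert[of "{1..n}" ?N G] G_meas' by simp
  finally show "(\<integral>\<^sup>+\<omega>. risk P (F (\<lambda>i. Z i \<omega>)) \<partial>M)
    = (\<integral>\<^sup>+D. ennreal ((F D (fst (D ?N)) - snd (D ?N))\<^sup>2) \<partial>?Q)"
    by (simp add: G_def)
qed

text \<open>A bound on the sum of squared leave-one-out errors by the squared residuals of the full ridge
  estimator and the leverages, valid on every sample with bounded labels, turns into a bound on the
  expected risk.\<close>

lemma expected_risk_le_oracle:
  fixes M :: "'w measure" and Z :: "nat \<Rightarrow> 'w \<Rightarrow> 'd obs"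
    and F :: "(nat \<Rightarrow> 'd obs) \<Rightarrow> real ^ 'd \<Rightarrow> real"
  assumes n: "n \<ge> 1" and l: "l > 0" and c: "c \<ge> 0" and k: "k \<ge> 0"
    and M: "prob_space M"
    and indep: "prob_space.indep_vars M (\<lambda>_. borel) Z {1..n}"
    and distr: "\<And>i. i \<in> {1..n} \<Longrightarrow> distr M borel (Z i) = P"
    and F_cong: "\<And>D D' x. (\<And>i. i \<in> {1..n} \<Longrightarrow> D i = D' i) \<Longrightarrow> F D x = F D' x"
    and F_meas: "(\<lambda>D. F D (fst (D (Suc n)))) \<in> borel_measurable (Pi\<^sub>M {1..Suc n} (\<lambda>_. borel))"
    and loo: "\<And>D. (\<And>i. i \<in> {1..Suc n} \<Longrightarrow> \<bar>snd (D i)\<bar> \<le> b) \<Longrightarrow>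
      (\<Sum>i=1..Suc n. (F (hold_out n i D) (fst (D i)) - snd (D i))\<^sup>2)
        \<le> (\<Sum>i=1..Suc n. (ridge (Suc n) l D \<bullet> fst (D i) - snd (D i))\<^sup>2)
          + c * (\<Sum>i=1..Suc n. leverage {1..Suc n} (l * real (Suc n)) D i) + k"
  shows "(\<integral>\<^sup>+\<omega>. risk P (F (\<lambda>i. Z i \<omega>)) \<partial>M)
    \<le> ridge_oracle_risk P l + ennreal (c * (deg_freedom P l / (real n + 1)))
      + ennreal (k / (real n + 1))"
proof -
  let ?N = "Suc n"
  let ?Q = "sample_measure {1..?N}"
  interpret Q: prob_space ?Q by (rule prob_space_sample)
  define G where "G D = ennreal ((F D (fst (D ?N)) - snd (D ?N))\<^sup>2)" for D
  note red = nn_integral_sample_eq_PiM[OF n M indep distr F_cong F_meas, folded G_def]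
  have G_meas: "G \<in> borel_measurable ?Q" using red(2) by (simp add: G_def[abs_def])
  define E where "E = (\<integral>\<^sup>+\<omega>. risk P (F (\<lambda>i. Z i \<omega>)) \<partial>M)"
  have E: "E = (\<integral>\<^sup>+D. G D \<partial>?Q)" using red(1) by (simp add: E_def)
  have G_hold: "G (hold_out n i D) = ennreal ((F (hold_out n i D) (fst (D i)) - snd (D i))\<^sup>2)" for i D
    by (simp add: G_def)
  have "of_nat ?N * E = (\<Sum>i=1..?N. (\<integral>\<^sup>+D. G (hold_out n i D) \<partial>?Q))"
  proof -
    have "(\<Sum>i=1..?N. (\<integral>\<^sup>+D. G (hold_out n i D) \<partial>?Q)) = (\<Sum>i=1..?N. E)"
      by (intro sum.cong refl) (simp only: nn_integral_hold_out(1)[OF _ G_meas] E)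
    then show ?thesis by (simp only: sum_constant card_atLeastAtMost diff_Suc_1)
  qed
  also have "\<dots> = (\<integral>\<^sup>+D. (\<Sum>i=1..?N. G (hold_out n i D)) \<partial>?Q)"
    by (rule nn_integral_sum[symmetric]) (rule nn_integral_hold_out(2)[OF _ G_meas])
  finally have NE: "of_nat ?N * E = (\<integral>\<^sup>+D. (\<Sum>i=1..?N. G (hold_out n i D)) \<partial>?Q)" .
  have df: "deg_freedom P l \<ge> 0" by (rule deg_freedom_nonneg[OF l])
  have bound: "E \<le> risk P (lin_pred \<theta>) + ennreal (l * (norm \<theta>)\<^sup>2)
      + ennreal (c * (deg_freedom P l / (real n + 1)) + k / (real n + 1))" for \<theta>
  proof -
    define R where "R = (\<integral>z. (\<theta> \<bullet> fst z - snd z)\<^sup>2 \<partial>P)"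
    have R: "R \<ge> 0" by (simp add: R_def)
    \<comment> \<open>An integrable upper bound of the sum of squared leave-one-out errors.\<close>
    define H where "H D = (\<Sum>i=1..?N. (\<theta> \<bullet> fst (D i) - snd (D i))\<^sup>2) + l * real ?N * (norm \<theta>)\<^sup>2
      + c * leverage_majorant ?N l D + k" for D
    have loss_int: "integrable ?Q (\<lambda>D. \<Sum>i=1..?N. (\<theta> \<bullet> fst (D i) - snd (D i))\<^sup>2)"
      by (rule Bochner_Integration.integrable_sum)
        (rule sample_component(1)[OF _ integrable_sq_loss])
    have loss_eq: "(\<integral>D. (\<Sum>i=1..?N. (\<theta> \<bullet> fst (D i) - snd (D i))\<^sup>2) \<partial>?Q) = real ?N * R"
      by (subst Bochner_Integration.integral_sum)
        (simp_all add: sample_component[OF _ integrable_sq_loss] R_def)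
    note maj = expectation_leverage_majorant[of ?N l, OF _ l, simplified]
    have H_int: "integrable ?Q H"
      unfolding H_def using loss_int maj(1) by simp
    have H_eq: "(\<integral>D. H D \<partial>?Q) = real ?N * R + l * real ?N * (norm \<theta>)\<^sup>2 + c * deg_freedom P l + k"
      unfolding H_def using loss_int maj loss_eq by (simp add: Q.prob_space)
    have H_ge: "(\<Sum>i=1..?N. (F (hold_out n i D) (fst (D i)) - snd (D i))\<^sup>2) \<le> H D"
      if "\<forall>i\<in>{1..?N}. \<bar>snd (D i)\<bar> \<le> b" for D
    proof -
      have "c * (\<Sum>i=1..?N. leverage {1..?N} (l * real ?N) D i) \<le> c * leverage_majorant ?N l D"
        by (intro mult_left_mono sum_leverage_le_majorant) (use l c in auto)
      then show ?thesis
        using loo[of D] that ridge_minimizes[of ?N l D \<theta>] l unfolding H_def by fastforce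
    qed
    have ae: "AE D in ?Q. \<forall>i\<in>{1..?N}. \<bar>snd (D i)\<bar> \<le> b" by (rule AE_sample_bounded) simp
    have H_nonneg: "AE D in ?Q. 0 \<le> H D"
      using ae 
    proof eventually_elim
      case (elim D)
      show ?case by (rule order_trans[OF _ H_ge[OF elim]], rule sum_nonneg) simp
    qed
    have "of_nat ?N * E \<le> (\<integral>\<^sup>+D. ennreal (H D) \<partial>?Q)"
      unfolding NE
    proof (rule nn_integral_mono_AE)
      show "AE D in ?Q. (\<Sum>i=1..?N. G (hold_out n i D)) \<le> ennreal (H D)"
        using ae
      proof eventually_elim
        case (elim D)
        show ?case
          unfolding G_hold using H_ge[OF elim] by (subst sum_ennreal) (auto intro: ennreal_leI)
      qed
    qed
    also have "\<dots> = ennreal (real ?N * (R + l * (norm \<theta>)\<^sup>2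
        + (c * (deg_freedom P l / (real n + 1)) + k / (real n + 1))))"
      unfolding nn_integral_eq_integral[OF H_int H_nonneg] H_eq
    proof (rule arg_cong[where f = ennreal])
      have "real ?N * (a / (real n + 1)) = a" for a by (simp add: add.commute)
      from this[of "c * deg_freedom P l"] this[of k]
      show "real ?N * R + l * real ?N * (norm \<theta>)\<^sup>2 + c * deg_freedom P l + k
        = real ?N * (R + l * (norm \<theta>)\<^sup>2
          + (c * (deg_freedom P l / (real n + 1)) + k / (real n + 1)))"
        by (simp only: distrib_left times_divide_eq_right) (simp only: mult_ac add_ac)
    qed
    also have "\<dots> = of_nat ?N * ennreal (R + l * (norm \<theta>)\<^sup>2
        + (c * (deg_freedom P l / (real n + 1)) + k / (real n + 1)))"
      by (subst ennreal_mult) (use R l c k df in \<open>simp_all add: ennreal_of_nat_eq_real_of_nat\<close>)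
    finally have "E \<le> ennreal (R + l * (norm \<theta>)\<^sup>2
        + (c * (deg_freedom P l / (real n + 1)) + k / (real n + 1)))"
      by (subst (asm) ennreal_mult_le_mult_iff) simp_all
    also have "\<dots> = risk P (lin_pred \<theta>) + ennreal (l * (norm \<theta>)\<^sup>2)
      + ennreal (c * (deg_freedom P l / (real n + 1)) + k / (real n + 1))"
      unfolding risk_lin_pred R_def[symmetric] using R l c k df by (simp add: ennreal_plus)
    finally show ?thesis .
  qed
  have "E \<le> ridge_oracle_risk P l
      + ennreal (c * (deg_freedom P l / (real n + 1)) + k / (real n + 1))"
    unfolding ridge_oracle_risk_def by (rule ennreal_le_INF_addI) (rule bound)
  then show ?thesis
    unfolding E_def using c k df by (simp add: ennreal_plus add.assoc)
qed

end

section \<open>The ridge FW and truncated ridge estimators\<close>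

lemma ridge_cong:
  assumes "\<And>i. i \<in> {1..n} \<Longrightarrow> D i = D' i"
  shows "ridge n \<mu> D = ridge n \<mu> D'"
proof -
  have "emp_risk n D = emp_risk n D'"
    unfolding emp_risk_def using assms by (intro ext arg_cong2[where f = "(/)"] sum.cong) auto
  then show ?thesis by (simp add: ridge_def)
qed

lemma ridge_leverage_cong:
  assumes "\<And>i. i \<in> {1..n} \<Longrightarrow> D i = D' i"
  shows "ridge_leverage n \<mu> D x = ridge_leverage n \<mu> D' x"
proof -
  have "(\<Sum>i=1..n. outer (fst (D i))) = (\<Sum>i=1..n. outer (fst (D' i)))"
    using assms by (intro sum.cong) auto
  then show ?thesis by (simp add: ridge_leverage_def)
qed

lemma max_abs_label_cong:
  assumes "\<And>i. i \<in> {1..n} \<Longrightarrow> D i = D' i"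
  shows "max_abs_label n D = max_abs_label n D'"
  unfolding max_abs_label_def using assms by (intro arg_cong[where f = Max] image_cong) auto

lemma ridge_fw_hold_out_error:
  assumes n: "n \<ge> 1" and l: "l > 0"
    and y: "\<And>i. i \<in> {1..Suc n} \<Longrightarrow> \<bar>snd (D i)\<bar> \<le> b"
  shows "(\<Sum>i=1..Suc n. (ridge_fw n l (hold_out n i D) (fst (D i)) - snd (D i))\<^sup>2)
    \<le> (\<Sum>i=1..Suc n. (ridge (Suc n) l D \<bullet> fst (D i) - snd (D i))\<^sup>2)
      + 2 * b\<^sup>2 * (\<Sum>i=1..Suc n. leverage {1..Suc n} (l * real (Suc n)) D i)"
  unfolding sum_distrib_left sum.distrib[symmetric]
proof (rule sum_mono)
  fix i assume i: "i \<in> {1..Suc n}"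
  let ?h = "leverage {1..Suc n} (l * real (Suc n)) D i"
  have h: "0 \<le> ?h" "?h \<le> 1" using i l by (auto intro: leverage_bounds)
  have "(snd (D i))\<^sup>2 \<le> b\<^sup>2" using power_mono[OF y[OF i], of 2] by simp
  then have "2 * ?h * (snd (D i))\<^sup>2 \<le> 2 * ?h * b\<^sup>2"
    using h by (intro mult_left_mono) auto
  then show "(ridge_fw n l (hold_out n i D) (fst (D i)) - snd (D i))\<^sup>2
      \<le> (ridge (Suc n) l D \<bullet> fst (D i) - snd (D i))\<^sup>2 + 2 * b\<^sup>2 * ?h"
    using fw_error_bound[OF hold_out_residual[OF n l i, of D] h]
    unfolding ridge_fw_def ridge_leverage_hold_out[OF n i] by (simp add: mult_ac)
qed

lemma trunc_ridge_hold_out_error: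
  assumes n: "n \<ge> 1" and l: "l > 0"
    and y: "\<And>i. i \<in> {1..Suc n} \<Longrightarrow> \<bar>snd (D i)\<bar> \<le> b"
    and a: "\<And>i. i \<in> {1..Suc n} \<Longrightarrow> 0 \<le> a i \<and> a i \<le> b"
  shows "(\<Sum>i=1..Suc n. (trunc_ridge n l (a i) (hold_out n i D) (fst (D i)) - snd (D i))\<^sup>2)
    \<le> (\<Sum>i=1..Suc n. (ridge (Suc n) l D \<bullet> fst (D i) - snd (D i))\<^sup>2)
      + 8 * b\<^sup>2 * (\<Sum>i=1..Suc n. leverage {1..Suc n} (l * real (Suc n)) D i)
      + (\<Sum>i=1..Suc n. if \<bar>snd (D i)\<bar> > a i then b\<^sup>2 else 0)"
  unfolding sum_distrib_left sum.distrib[symmetric]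
proof (rule sum_mono)
  fix i assume i: "i \<in> {1..Suc n}"
  let ?h = "leverage {1..Suc n} (l * real (Suc n)) D i"
  have "0 \<le> ?h" "?h \<le> 1" using i l by (auto intro: leverage_bounds)
  then show "(trunc_ridge n l (a i) (hold_out n i D) (fst (D i)) - snd (D i))\<^sup>2
      \<le> (ridge (Suc n) l D \<bullet> fst (D i) - snd (D i))\<^sup>2 + 8 * b\<^sup>2 * ?h
        + (if \<bar>snd (D i)\<bar> > a i then b\<^sup>2 else 0)"
    using a[OF i] y[OF i] unfolding trunc_ridge_def
    by (intro trunc_error_bound hold_out_residual n l i) auto
qed

lemma max_abs_label_hold_out:
  assumes "i \<in> {1..Suc n}"
  shows "max_abs_label n (hold_out n i D) = Max ((\<lambda>j. \<bar>snd (D j)\<bar>) ` ({1..Suc n} - {i}))"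
  unfolding max_abs_label_def image_transpose_last[OF assms, symmetric] image_image by simp

text \<open>At most one label is larger in absolute value than all the others.\<close>

lemma sum_exceeding_held_out_max:
  fixes c :: real
  assumes "c \<ge> 0"
  shows "(\<Sum>i=1..Suc n. if \<bar>snd (D i)\<bar> > max_abs_label n (hold_out n i D) then c else 0) \<le> c"
proof -
  let ?S = "{i \<in> {1..Suc n}. \<bar>snd (D i)\<bar> > max_abs_label n (hold_out n i D)}"
  have less: "\<bar>snd (D j)\<bar> < \<bar>snd (D i)\<bar>" if "i \<in> ?S" "j \<in> ?S" "i \<noteq> j" for i j
  proof -
    have "\<bar>snd (D j)\<bar> \<le> max_abs_label n (hold_out n i D)"
      using that by (subst max_abs_label_hold_out) (auto intro!: Max_ge)
    then show ?thesis using that by auto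
  qed
  have "card ?S \<le> Suc 0"
    using less by (subst card_le_Suc0_iff_eq) (auto, metis (lifting) less_asym mem_Collect_eq)
  then have "real (card ?S) * c \<le> 1 * c" using assms by (intro mult_right_mono) auto
  moreover have "(\<Sum>i=1..Suc n. if \<bar>snd (D i)\<bar> > max_abs_label n (hold_out n i D) then c else 0)
      = real (card ?S) * c"
    by (subst sum.inter_filter[symmetric]) (simp_all only: finite_atLeastAtMost sum_constant)
  ultimately show ?thesis by simp
qed

lemma borel_measurable_adj_ridge_pred:
  assumes "l > 0"
  shows "(\<lambda>D. ridge n (adj_lambda n l) D \<bullet> fst (D (Suc n)))
      \<in> borel_measurable (Pi\<^sub>M {1..Suc n} (\<lambda>_. borel :: ('d::finite) obs measure))"
  by (rule borel_measurable_ridge_pred[OF adj_lambda_pos[OF assms]]) auto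

lemma borel_measurable_max_abs_label:
  "(\<lambda>D. max_abs_label n D)
    \<in> borel_measurable (Pi\<^sub>M {1..Suc n} (\<lambda>_. borel :: ('d::finite) obs measure))"
  unfolding max_abs_label_def
  by (intro borel_measurable_Max borel_measurable_abs measurable_obs(2)) auto

section \<open>Excess risk bounds\<close>

lemma (in bounded_label_distribution) ridge_fw_risk_bound:
  fixes M :: "'w measure" and Z :: "nat \<Rightarrow> 'w \<Rightarrow> 'd obs"
  assumes n: "n \<ge> 1" and l: "l > 0"
    and M: "prob_space M"
    and indep: "prob_space.indep_vars M (\<lambda>_. borel) Z {1..n}"
    and distr: "\<And>i. i \<in> {1..n} \<Longrightarrow> distr M borel (Z i) = P"
  shows "(\<integral>\<^sup>+ \<omega>. risk P (ridge_fw n l (\<lambda>i. Z i \<omega>)) \<partial>M)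
    \<le> ridge_oracle_risk P l + ennreal (2 * b\<^sup>2 * (deg_freedom P l / (real n + 1)))"
proof -
  have "(\<integral>\<^sup>+ \<omega>. risk P (ridge_fw n l (\<lambda>i. Z i \<omega>)) \<partial>M)
    \<le> ridge_oracle_risk P l + ennreal (2 * b\<^sup>2 * (deg_freedom P l / (real n + 1)))
      + ennreal (0 / (real n + 1))"
  proof (rule expected_risk_le_oracle[OF n l _ _ M indep distr])
    show "ridge_fw n l D x = ridge_fw n l D' x" if "\<And>i. i \<in> {1..n} \<Longrightarrow> D i = D' i" for D D' x
      by (simp only: ridge_fw_def ridge_cong[of n D D'] ridge_leverage_cong[of n D D'] that)
    show "(\<lambda>D. ridge_fw n l D (fst (D (Suc n))))
        \<in> borel_measurable (Pi\<^sub>M {1..Suc n} (\<lambda>_. borel :: 'd obs measure))"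
      unfolding ridge_fw_def
      by (intro borel_measurable_times borel_measurable_power borel_measurable_diff
          borel_measurable_const borel_measurable_adj_ridge_pred[OF l]
          borel_measurable_ridge_leverage[OF adj_lambda_pos[OF l] n]) auto
    fix D :: "nat \<Rightarrow> 'd obs" assume y: "\<And>i. i \<in> {1..Suc n} \<Longrightarrow> \<bar>snd (D i)\<bar> \<le> b"
    show "(\<Sum>i=1..Suc n. (ridge_fw n l (hold_out n i D) (fst (D i)) - snd (D i))\<^sup>2)
        \<le> (\<Sum>i=1..Suc n. (ridge (Suc n) l D \<bullet> fst (D i) - snd (D i))\<^sup>2)
          + 2 * b\<^sup>2 * (\<Sum>i=1..Suc n. leverage {1..Suc n} (l * real (Suc n)) D i) + 0"
      by (simp only: add_0_right ridge_fw_hold_out_error[OF n l y])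
  qed auto
  then show ?thesis by simp
qed

lemma (in bounded_label_distribution) trunc_ridge_risk_bound:
  fixes M :: "'w measure" and Z :: "nat \<Rightarrow> 'w \<Rightarrow> 'd obs"
  assumes n: "n \<ge> 1" and l: "l > 0" and b: "b > 0"
    and M: "prob_space M"
    and indep: "prob_space.indep_vars M (\<lambda>_. borel) Z {1..n}"
    and distr: "\<And>i. i \<in> {1..n} \<Longrightarrow> distr M borel (Z i) = P"
  shows "(\<integral>\<^sup>+ \<omega>. risk P (trunc_ridge n l b (\<lambda>i. Z i \<omega>)) \<partial>M)
    \<le> ridge_oracle_risk P l + ennreal (8 * b\<^sup>2 * (deg_freedom P l / (real n + 1)))"
proof -
  have "(\<integral>\<^sup>+ \<omega>. risk P (trunc_ridge n l b (\<lambda>i. Z i \<omega>)) \<partial>M)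
    \<le> ridge_oracle_risk P l + ennreal (8 * b\<^sup>2 * (deg_freedom P l / (real n + 1)))
      + ennreal (0 / (real n + 1))"
  proof (rule expected_risk_le_oracle[OF n l _ _ M indep distr])
    show "trunc_ridge n l b D x = trunc_ridge n l b D' x"
      if "\<And>i. i \<in> {1..n} \<Longrightarrow> D i = D' i" for D D' x
      by (simp only: trunc_ridge_def ridge_cong[of n D D'] that)
    show "(\<lambda>D. trunc_ridge n l b D (fst (D (Suc n))))
        \<in> borel_measurable (Pi\<^sub>M {1..Suc n} (\<lambda>_. borel :: 'd obs measure))"
      unfolding trunc_ridge_def trunc_def
      by (intro borel_measurable_max borel_measurable_min borel_measurable_const
          borel_measurable_adj_ridge_pred[OF l])
    fix D :: "nat \<Rightarrow> 'd obs" assume y: "\<And>i. i \<in> {1..Suc n} \<Longrightarrow> \<bar>snd (D i)\<bar> \<le> b"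
    have none: "(\<Sum>i=1..Suc n. if \<bar>snd (D i)\<bar> > b then b\<^sup>2 else 0) \<le> 0"
      by (rule sum_nonpos) (use y in force)
    have a: "0 \<le> b \<and> b \<le> b" using b by simp
    show "(\<Sum>i=1..Suc n. (trunc_ridge n l b (hold_out n i D) (fst (D i)) - snd (D i))\<^sup>2)
        \<le> (\<Sum>i=1..Suc n. (ridge (Suc n) l D \<bullet> fst (D i) - snd (D i))\<^sup>2)
          + 8 * b\<^sup>2 * (\<Sum>i=1..Suc n. leverage {1..Suc n} (l * real (Suc n)) D i) + 0"
      by (rule order_trans[OF trunc_ridge_hold_out_error[OF n l, where a = "\<lambda>_. b"]])
        (erule y | rule a | rule add_left_mono[OF none])+
  qed auto
  then show ?thesis by simp
qed

lemma (in bounded_label_distribution) trunc_ridge_max_label_risk_bound: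
  fixes M :: "'w measure" and Z :: "nat \<Rightarrow> 'w \<Rightarrow> 'd obs"
  assumes n: "n \<ge> 1" and l: "l > 0"
    and M: "prob_space M"
    and indep: "prob_space.indep_vars M (\<lambda>_. borel) Z {1..n}"
    and distr: "\<And>i. i \<in> {1..n} \<Longrightarrow> distr M borel (Z i) = P"
  shows "(\<integral>\<^sup>+ \<omega>. risk P (trunc_ridge n l (max_abs_label n (\<lambda>i. Z i \<omega>)) (\<lambda>i. Z i \<omega>)) \<partial>M)
    \<le> ridge_oracle_risk P l + ennreal (8 * b\<^sup>2 * (deg_freedom P l / (real n + 1)))
      + ennreal (b\<^sup>2 / (real n + 1))"
proof (rule expected_risk_le_oracle[OF n l _ _ M indep distr,
      where F = "\<lambda>D. trunc_ridge n l (max_abs_label n D) D"])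
  show "trunc_ridge n l (max_abs_label n D) D x = trunc_ridge n l (max_abs_label n D') D' x"
    if "\<And>i. i \<in> {1..n} \<Longrightarrow> D i = D' i" for D D' x
    by (simp only: trunc_ridge_def ridge_cong[of n D D'] max_abs_label_cong[of n D D'] that)
  show "(\<lambda>D. trunc_ridge n l (max_abs_label n D) D (fst (D (Suc n))))
      \<in> borel_measurable (Pi\<^sub>M {1..Suc n} (\<lambda>_. borel :: 'd obs measure))"
    unfolding trunc_ridge_def trunc_def
    by (intro borel_measurable_max borel_measurable_min borel_measurable_uminus
        borel_measurable_adj_ridge_pred[OF l] borel_measurable_max_abs_label)
  fix D :: "nat \<Rightarrow> 'd obs" assume y: "\<And>i. i \<in> {1..Suc n} \<Longrightarrow> \<bar>snd (D i)\<bar> \<le> b"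
  have a: "0 \<le> max_abs_label n (hold_out n i D) \<and> max_abs_label n (hold_out n i D) \<le> b"
    if i: "i \<in> {1..Suc n}" for i
  proof -
    let ?J = "{1..Suc n} - {i}"
    have "?J \<noteq> {}"
      unfolding image_transpose_last[OF i, symmetric] using n by simp
    then have "Max ((\<lambda>j. \<bar>snd (D j)\<bar>) ` ?J) \<in> (\<lambda>j. \<bar>snd (D j)\<bar>) ` ?J"
      by (intro Max_in) auto
    then show ?thesis unfolding max_abs_label_hold_out[OF i] using y by auto
  qed
  show "(\<Sum>i=1..Suc n. (trunc_ridge n l (max_abs_label n (hold_out n i D)) (hold_out n i D) (fst (D i))
          - snd (D i))\<^sup>2)
      \<le> (\<Sum>i=1..Suc n. (ridge (Suc n) l D \<bullet> fst (D i) - snd (D i))\<^sup>2)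
        + 8 * b\<^sup>2 * (\<Sum>i=1..Suc n. leverage {1..Suc n} (l * real (Suc n)) D i) + b\<^sup>2"
    by (rule order_trans[OF trunc_ridge_hold_out_error[OF n l,
            where a = "\<lambda>i. max_abs_label n (hold_out n i D)"]])
      (erule y | erule a | rule add_left_mono[OF sum_exceeding_held_out_max[OF zero_le_power2]])+
qed auto

theorem theorem4:
  fixes P :: "('d::finite) obs measure"
    and M :: "'w measure"
    and Z :: "nat \<Rightarrow> 'w \<Rightarrow> 'd obs"
    and n :: nat and l b :: real
  assumes n: "n \<ge> 1" and l: "l > 0" and b: "b > 0"
    and P: "prob_space P" "sets P = sets borel"
    and bounded_label: "AE z in P. \<bar>snd z\<bar> \<le> b"
    and second_moment_exists: "integrable P (\<lambda>z. outer (fst z))"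
    and M: "prob_space M"
    and indep: "prob_space.indep_vars M (\<lambda>_. borel) Z {1..n}"
    and distr: "\<And>i. i \<in> {1..n} \<Longrightarrow> distr M borel (Z i) = P"
  shows "(\<integral>\<^sup>+ \<omega>. risk P (ridge_fw n l (\<lambda>i. Z i \<omega>)) \<partial>M)
           \<le> ridge_oracle_risk P l + ennreal (2 * b\<^sup>2 * (deg_freedom P l / (real n + 1)))
    \<and> (\<integral>\<^sup>+ \<omega>. risk P (trunc_ridge n l b (\<lambda>i. Z i \<omega>)) \<partial>M)
           \<le> ridge_oracle_risk P l + ennreal (8 * b\<^sup>2 * (deg_freedom P l / (real n + 1)))
    \<and> (\<integral>\<^sup>+ \<omega>. risk P (trunc_ridge n l (max_abs_label n (\<lambda>i. Z i \<omega>)) (\<lambda>i. Z i \<omega>)) \<partial>M)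
           \<le> ridge_oracle_risk P l + ennreal (8 * b\<^sup>2 * (deg_freedom P l / (real n + 1)))
              + ennreal (b\<^sup>2 / (real n + 1))"
proof -
  interpret bounded_label_distribution P b
    by (intro bounded_label_distribution.intro P bounded_label second_moment_exists)
  note sample = M indep distr
  show ?thesis
    using ridge_fw_risk_bound[OF n l sample] trunc_ridge_risk_bound[OF n l b sample]
      trunc_ridge_max_label_risk_bound[OF n l sample] by blast
qed

end
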